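(* Let $(Y,G,Z)$ be random variables on a common probability space with $Y,Z$ real-valued with finite first and second moments and $G\in\{0,1\}$. Suppose $Z$ is globally calibrated, i.e. $\mathbb{E}[Y\mid Z=z]=z$ for all $z$. Then $$\sum_y \delta_B(y)\,\omega_Y(y)+\sum_z\delta_C(z)\,\omega_Z(z)=\mathrm{Cov}\bigl(\mathbb{E}[G\mid Y],\,Y-\mathbb{E}[Z\mid Y]\bigr).$$ (The first sum is $\delta_B$ and the second is $\delta_C$.)
   Context: $Y$ is an outcome (not necessarily binary), $G$ a binary group indicator, $Z$ a risk score. Pointwise miscalibration: $\delta_C(z)=\mathbb{E}[Y\mid Z=z,G=1]-\mathbb{E}[Y\mid Z=z,G=0]$, with weight $\omega_Z(z)=\mathrm{Var}(G\mid Z=z)\,P(Z=z)$, and $\delta_C=\sum_z\delta_C(z)\,\omega_Z(z)$. Pointwise imbalance: $\delta_B(y)=\mathbb{E}[Z\mid Y=y,G=1]-\mathbb{E}[Z\mid Y=y,G=0]$, with weight $\omega_Y(y)=\mathrm{Var}(G\mid Y=y)\,P(Y=y)$, and $\delta_B=\sum_y\delta_B(y)\,\omega_Y(y)$. If $Z$ (resp. $Y$) is not discrete, the corresponding sum is replaced by an integral and the point probability by the density, i.e. $\delta_C=\int \delta_C(z)\,\mathrm{Var}(G\mid Z=z)\,dP_Z(z)$ and $\delta_B=\int\delta_B(y)\,\mathrm{Var}(G\mid Y=y)\,dP_Y(y)$, where $P_Z,P_Y$ are the laws of $Z,Y$. Conventions: statements about conditional expectations given $Z=z$ or $Y=y$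 hold for almost every value with respect to the corresponding law (so global calibration means $\mathbb{E}[Y\mid Z]=Z$ almost surely); a term whose weight vanishes because only one group is present (so that $\delta_C(z)$ or $\delta_B(y)$ is undefined) is taken to be $0$. *)

theory Defs
  imports "HOL-Probability.Probability"
begin

(* E[Y | X = x] as a function of x: a measurable f such that f(X) is a version of E[Y | sigma(X)].
   It is determined up to null sets of the law of X. *)
definition cond_exp_at ::
    "'a measure \<Rightarrow> 'b measure \<Rightarrow> ('a \<Rightarrow> 'b) \<Rightarrow> ('a \<Rightarrow> real) \<Rightarrow> 'b \<Rightarrow> real" where
  "cond_exp_at M N X Y =
     (SOME f. f \<in> borel_measurable N \<and>
        (AE \<omega> in M. real_cond_exp M (vimage_algebra (space M) X N) Y \<omega> = f (X \<omega>)))"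

definition cond_var_at ::
    "'a measure \<Rightarrow> 'b measure \<Rightarrow> ('a \<Rightarrow> 'b) \<Rightarrow> ('a \<Rightarrow> real) \<Rightarrow> 'b \<Rightarrow> real" where
  "cond_var_at M N X Y = cond_exp_at M N X (\<lambda>\<omega>. (Y \<omega> - cond_exp_at M N X Y (X \<omega>))\<^sup>2)"

definition covariance :: "'a measure \<Rightarrow> ('a \<Rightarrow> real) \<Rightarrow> ('a \<Rightarrow> real) \<Rightarrow> real" where
  "covariance M U V =
     (\<integral>\<omega>. (U \<omega> - (\<integral>\<omega>'. U \<omega>' \<partial>M)) * (V \<omega> - (\<integral>\<omega>'. V \<omega>' \<partial>M)) \<partial>M)"

definition pointwise_miscalibration ::
    "'a measure \<Rightarrow> ('a \<Rightarrow> real) \<Rightarrow> ('a \<Rightarrow> real) \<Rightarrow> ('a \<Rightarrow> real) \<Rightarrow> real \<Rightarrow> real" where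
  "pointwise_miscalibration M Y G Z z =
     cond_exp_at M (borel \<Otimes>\<^sub>M borel) (\<lambda>\<omega>. (Z \<omega>, G \<omega>)) Y (z, 1)
   - cond_exp_at M (borel \<Otimes>\<^sub>M borel) (\<lambda>\<omega>. (Z \<omega>, G \<omega>)) Y (z, 0)"

definition pointwise_imbalance ::
    "'a measure \<Rightarrow> ('a \<Rightarrow> real) \<Rightarrow> ('a \<Rightarrow> real) \<Rightarrow> ('a \<Rightarrow> real) \<Rightarrow> real \<Rightarrow> real" where
  "pointwise_imbalance M Y G Z y =
     cond_exp_at M (borel \<Otimes>\<^sub>M borel) (\<lambda>\<omega>. (Y \<omega>, G \<omega>)) Z (y, 1)
   - cond_exp_at M (borel \<Otimes>\<^sub>M borel) (\<lambda>\<omega>. (Y \<omega>, G \<omega>)) Z (y, 0)"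

(* Integrands against the laws of Z and Y. Where only one group is present the variance factor
   is 0, so the arbitrary value of the pointwise gap there contributes 0. *)
definition miscalibration_term ::
    "'a measure \<Rightarrow> ('a \<Rightarrow> real) \<Rightarrow> ('a \<Rightarrow> real) \<Rightarrow> ('a \<Rightarrow> real) \<Rightarrow> real \<Rightarrow> real" where
  "miscalibration_term M Y G Z z = pointwise_miscalibration M Y G Z z * cond_var_at M borel Z G z"

definition imbalance_term ::
    "'a measure \<Rightarrow> ('a \<Rightarrow> real) \<Rightarrow> ('a \<Rightarrow> real) \<Rightarrow> ('a \<Rightarrow> real) \<Rightarrow> real \<Rightarrow> real" where
  "imbalance_term M Y G Z y = pointwise_imbalance M Y G Z y * cond_var_at M borel Y G y"

(* For discrete Z (resp. Y) the integral against the law is the sum with the point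
   probabilities P(Z = z) (resp. P(Y = y)) as weights. *)
definition miscalibration ::
    "'a measure \<Rightarrow> ('a \<Rightarrow> real) \<Rightarrow> ('a \<Rightarrow> real) \<Rightarrow> ('a \<Rightarrow> real) \<Rightarrow> real" where
  "miscalibration M Y G Z = (\<integral>z. miscalibration_term M Y G Z z \<partial>distr M borel Z)"

definition imbalance ::
    "'a measure \<Rightarrow> ('a \<Rightarrow> real) \<Rightarrow> ('a \<Rightarrow> real) \<Rightarrow> ('a \<Rightarrow> real) \<Rightarrow> real" where
  "imbalance M Y G Z = (\<integral>y. imbalance_term M Y G Z y \<partial>distr M borel Y)"

definition globally_calibrated :: "'a measure \<Rightarrow> ('a \<Rightarrow> real) \<Rightarrow> ('a \<Rightarrow> real) \<Rightarrow> bool" where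
  "globally_calibrated M Y Z \<longleftrightarrow> (AE z in distr M borel Z. cond_exp_at M borel Z Y z = z)"


lemma vimage_algebra_factor_ennreal:
  fixes u :: "'a \<Rightarrow> ennreal"
  assumes X: "X \<in> \<Omega> \<rightarrow> space N" and u: "u \<in> borel_measurable (vimage_algebra \<Omega> X N)"
  shows "\<exists>g\<in>borel_measurable N. \<forall>\<omega>\<in>\<Omega>. u \<omega> = g (X \<omega>)"
  using u
proof (induction rule: borel_measurable_induct)
  case (cong f g)
  then show ?case by auto
next
  case (set A)
  then obtain B where B: "B \<in> sets N" "A = X -` B \<inter> \<Omega>"
    unfolding sets_vimage_algebra2[OF X] by blast
  then show ?case
    by (intro bexI[of _ "indicator B"]) (auto simp: indicator_def)
next
  case (mult u c)
  obtain g where "g \<in> borel_measurable N" "\<forall>\<omega>\<in>\<Omega>. u \<omega> = g (X \<omega>)"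
    using mult.IH by (elim bexE) simp
  then show ?case by (intro bexI[of _ "\<lambda>x. c * g x"]) simp_all
next
  case (add u v)
  obtain g where "g \<in> borel_measurable N" "\<forall>\<omega>\<in>\<Omega>. u \<omega> = g (X \<omega>)"
    using add.IH(1) by (elim bexE) simp
  moreover obtain h where "h \<in> borel_measurable N" "\<forall>\<omega>\<in>\<Omega>. v \<omega> = h (X \<omega>)"
    using add.IH(2) by (elim bexE) simp
  ultimately show ?case by (intro bexI[of _ "\<lambda>x. h x + g x"]) simp_all
next
  case (seq U)
  have "\<forall>i. \<exists>g. g \<in> borel_measurable N \<and> (\<forall>\<omega>\<in>\<Omega>. U i \<omega> = g (X \<omega>))"
    using seq.IH by blast
  then obtain g where "\<And>i::nat. g i \<in> borel_measurable N" "\<And>i. \<forall>\<omega>\<in>\<Omega>. U i \<omega> = g i (X \<omega>)"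
    by metis
  then show ?case
    by (intro bexI[of _ "\<lambda>x. SUP i. g i x"]) (simp_all add: image_comp)
qed

lemma cond_exp_at_version:
  assumes "X \<in> measurable M N"
  shows "cond_exp_at M N X Y \<in> borel_measurable N"
    and "AE \<omega> in M. real_cond_exp M (vimage_algebra (space M) X N) Y \<omega> = cond_exp_at M N X Y (X \<omega>)"
proof -
  let ?F = "vimage_algebra (space M) X N"
  let ?f = "real_cond_exp M ?F Y"
  have X: "X \<in> space M \<rightarrow> space N" using assms by (auto dest: measurable_space)
  have "(\<lambda>\<omega>. ennreal (?f \<omega>)) \<in> borel_measurable ?F" "(\<lambda>\<omega>. ennreal (- ?f \<omega>)) \<in> borel_measurable ?F"
    by simp_all
  note fac = this[THEN vimage_algebra_factor_ennreal[OF X]]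
  obtain g where g: "g \<in> borel_measurable N" "\<forall>\<omega>\<in>space M. ennreal (?f \<omega>) = g (X \<omega>)"
    using fac(1) by (elim bexE)
  obtain h where h: "h \<in> borel_measurable N" "\<forall>\<omega>\<in>space M. ennreal (- ?f \<omega>) = h (X \<omega>)"
    using fac(2) by (elim bexE)
  have "?f \<omega> = enn2real (g (X \<omega>)) - enn2real (h (X \<omega>))" if "\<omega> \<in> space M" for \<omega>
  proof -
    have "g (X \<omega>) = ennreal (?f \<omega>)" "h (X \<omega>) = ennreal (- ?f \<omega>)"
      using g(2) h(2) that by metis+
    then show ?thesis by (cases "?f \<omega> \<ge> 0") (simp_all add: ennreal_neg)
  qed
  then have "\<exists>f. f \<in> borel_measurable N \<and> (AE \<omega> in M. ?f \<omega> = f (X \<omega>))"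
    using g(1) h(1) by (intro exI[of _ "\<lambda>x. enn2real (g x) - enn2real (h x)"]) auto
  from someI_ex[OF this]
  show "cond_exp_at M N X Y \<in> borel_measurable N" "AE \<omega> in M. ?f \<omega> = cond_exp_at M N X Y (X \<omega>)"
    unfolding cond_exp_at_def by auto
qed

lemma cond_exp_at_atom:
  assumes "prob_space M" and X: "X \<in> measurable M N" and Y: "integrable M Y"
    and x: "{x} \<in> sets N" and pos: "measure M {\<omega>\<in>space M. X \<omega> = x} > 0"
  shows "cond_exp_at M N X Y x
    = (\<integral>\<omega>. indicator {\<omega>\<in>space M. X \<omega> = x} \<omega> * Y \<omega> \<partial>M) / measure M {\<omega>\<in>space M. X \<omega> = x}"
proof -
  interpret prob_space M by fact
  let ?F = "vimage_algebra (space M) X N" and ?A = "{\<omega>\<in>space M. X \<omega> = x}"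
  have sp: "X \<in> space M \<rightarrow> space N" using X by (auto dest: measurable_space)
  have sub: "subalgebra M ?F"
    using X by (auto simp: subalgebra_def sets_vimage_algebra2[OF sp])
  then interpret finite_measure_subalgebra M ?F by unfold_locales
  have Aeq: "?A = X -` {x} \<inter> space M" by auto
  have A: "?A \<in> sets ?F" unfolding Aeq using x by (rule in_vimage_algebra)
  then have AM: "?A \<in> sets M" using sub by (auto simp: subalgebra_def)
  have "(\<integral>\<omega>\<in>?A. Y \<omega> \<partial>M) = (\<integral>\<omega>\<in>?A. real_cond_exp M ?F Y \<omega> \<partial>M)"
    by (rule real_cond_exp_intA[OF Y A])
  also have "\<dots> = (\<integral>\<omega>. indicator ?A \<omega> * cond_exp_at M N X Y x \<partial>M)"
    unfolding set_lebesgue_integral_def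
  proof (rule integral_cong_AE)
    show "(\<lambda>\<omega>. indicator ?A \<omega> *\<^sub>R real_cond_exp M ?F Y \<omega>) \<in> borel_measurable M"
      using AM borel_measurable_cond_exp2 by measurable
    show "(\<lambda>\<omega>. indicator ?A \<omega> * cond_exp_at M N X Y x) \<in> borel_measurable M"
      using AM by measurable
    show "AE \<omega> in M. indicator ?A \<omega> *\<^sub>R real_cond_exp M ?F Y \<omega> = indicator ?A \<omega> * cond_exp_at M N X Y x"
      using cond_exp_at_version(2)[OF X, of Y] by eventually_elim (auto simp: indicator_def)
  qed
  also have "\<dots> = measure M ?A * cond_exp_at M N X Y x" using AM by (simp add: Int_absorb2 sets.sets_into_space)
  finally show ?thesis using pos by (simp add: set_lebesgue_integral_def field_simps)
qed

end

theory Submission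
  imports Defs
begin

text \<open>
  The weighted gap at \<open>x\<close> is a conditional covariance:
  \<open>(E[W | X, G = 1] - E[W | X, G = 0]) Var(G | X) = E[G W | X] - E[G | X] E[W | X]\<close>, since
  \<open>E[W | X] = p a + (1 - p) b\<close> and \<open>E[G W | X] = p a\<close> for the two group means \<open>a, b\<close> and
  \<open>p = E[G | X]\<close>. Integrating, the imbalance is \<open>E[G Z] - E[E[G | Y] E[Z | Y]]\<close> and, by
  calibration, the miscalibration is \<open>E[G Y] - E[G Z]\<close>. Their sum is
  \<open>E[E[G | Y] (Y - E[Z | Y])]\<close>, which is the covariance because calibration gives
  \<open>E[Y] = E[Z]\<close>.
\<close>

section \<open>Sigma-algebras generated by a random variable, and pulling factors out of conditional
  expectations\<close>

lemma subalgebra_vimage_algebra: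
  assumes "X \<in> measurable M N"
  shows "subalgebra M (vimage_algebra (space M) X N)"
proof -
  have "X \<in> space M \<rightarrow> space N"
    using assms by (auto dest: measurable_space)
  then show ?thesis
    using assms by (auto simp: subalgebra_def sets_vimage_algebra2)
qed

lemma (in finite_measure) finite_measure_subalgebra_vimage:
  assumes "X \<in> measurable M N"
  shows "finite_measure_subalgebra M (vimage_algebra (space M) X N)"
  using subalgebra_vimage_algebra[OF assms] by unfold_locales

lemma measurable_comp_vimage_algebra:
  assumes X: "X \<in> measurable M N" and f: "f \<in> measurable N K"
  shows "(\<lambda>\<omega>. f (X \<omega>)) \<in> measurable (vimage_algebra (space M) X N) K"
proof -
  have "X \<in> measurable (vimage_algebra (space M) X N) N"
    using X by (intro measurable_vimage_algebra1) (auto dest: measurable_space)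
  then show ?thesis
    using f by (rule measurable_compose)
qed

text \<open>Tower property: conditioning first on \<open>H\<close> pulls out \<open>J\<close> and
  turns \<open>J * W\<close> into \<open>a * J\<close>; conditioning then on \<open>F\<close> pulls
  out \<open>a\<close>. In the application \<open>J\<close> indicates a group and \<open>a\<close>
  is the mean of \<open>W\<close> in that group given \<open>X\<close>, so the relation between
  group mean and conditional expectation comes without dividing by the conditional probability of
  the group.\<close>

lemma (in sigma_finite_subalgebra) real_cond_exp_nested_factor:
  fixes J W a :: "'a \<Rightarrow> real"
  assumes H: "subalgebra M H" "subalgebra H F"
    and J: "J \<in> borel_measurable H" and a: "a \<in> borel_measurable F"
    and W: "integrable M W" and JW: "integrable M (\<lambda>\<omega>. J \<omega> * W \<omega>)"
    and eq: "AE \<omega> in M. J \<omega> * real_cond_exp M H W \<omega> = a \<omega> * J \<omega>"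
  shows "AE \<omega> in M. real_cond_exp M F (\<lambda>\<omega>. J \<omega> * W \<omega>) \<omega> = a \<omega> * real_cond_exp M F J \<omega>"
proof -
  interpret H: sigma_finite_subalgebra M H
    by (rule nested_subalg_is_sigma_finite[OF H])
  have JM [measurable]: "J \<in> borel_measurable M"
    by (rule measurable_from_subalg[OF H(1) J])
  have aM [measurable]: "a \<in> borel_measurable M"
    by (rule measurable_from_subalg[OF subalg a])
  have aJ: "AE \<omega> in M. real_cond_exp M H (\<lambda>\<omega>. J \<omega> * W \<omega>) \<omega> = a \<omega> * J \<omega>"
    using H.real_cond_exp_mult[OF J _ JW] W eq by auto
  \<comment> \<open>No bound on \<open>a\<close> is at hand; integrability comes from the
    conditional expectation of \<open>J * W\<close> given \<open>H\<close>, which agrees with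
    \<open>a * J\<close> almost everywhere.\<close>
  have int: "integrable M (\<lambda>\<omega>. a \<omega> * J \<omega>)"
    by (rule integrable_cong_AE_imp[OF H.real_cond_exp_int(1)[OF JW]]) (use aJ in auto)
  have "AE \<omega> in M. real_cond_exp M F (real_cond_exp M H (\<lambda>\<omega>. J \<omega> * W \<omega>)) \<omega>
      = real_cond_exp M F (\<lambda>\<omega>. a \<omega> * J \<omega>) \<omega>"
    by (rule real_cond_exp_cong[OF aJ]) auto
  with real_cond_exp_nested_subalg[OF H JW] real_cond_exp_mult[OF a JM int]
  show ?thesis by auto
qed

lemma (in finite_measure) integrable_mult_unit:
  fixes p f :: "'a \<Rightarrow> real"
  assumes "p \<in> borel_measurable M" "AE \<omega> in M. 0 \<le> p \<omega> \<and> p \<omega> \<le> 1" "integrable M f"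
  shows "integrable M (\<lambda>\<omega>. p \<omega> * f \<omega>)"
proof (rule Bochner_Integration.integrable_bound[OF assms(3)])
  show "(\<lambda>\<omega>. p \<omega> * f \<omega>) \<in> borel_measurable M"
    using assms by auto
  show "AE \<omega> in M. norm (p \<omega> * f \<omega>) \<le> norm (f \<omega>)"
    using assms(2) by eventually_elim (auto simp: abs_mult intro!: mult_left_le_one_le)
qed

section \<open>Conditional mean and variance of a binary variable\<close>

context finite_measure_subalgebra
begin

context
  fixes G :: "'a \<Rightarrow> real"
  assumes G [measurable]: "G \<in> borel_measurable M"
    and bin: "\<And>\<omega>. \<omega> \<in> space M \<Longrightarrow> G \<omega> \<in> {0, 1}"
begin

lemma integrable_mult_binary:
  fixes f :: "'a \<Rightarrow> real"
  assumes "integrable M f"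
  shows "integrable M (\<lambda>\<omega>. G \<omega> * f \<omega>)"
  by (rule integrable_mult_unit[OF G _ assms]) (use bin in force)

lemma integrable_binary: "integrable M G"
  using integrable_mult_binary[of "\<lambda>_. 1"] by simp

lemma real_cond_exp_binary_bounds:
  "AE \<omega> in M. 0 \<le> real_cond_exp M F G \<omega> \<and> real_cond_exp M F G \<omega> \<le> 1"
proof -
  have "AE \<omega> in M. 0 \<le> G \<omega>" "AE \<omega> in M. G \<omega> \<le> 1"
    using bin by force+
  with real_cond_exp_ge_c[OF integrable_binary, of 0] real_cond_exp_le_c[OF integrable_binary, of 1]
  show ?thesis by auto
qed

lemma integrable_real_cond_exp_binary_mult:
  fixes f :: "'a \<Rightarrow> real"
  assumes "integrable M f"
  shows "integrable M (\<lambda>\<omega>. real_cond_exp M F G \<omega> * f \<omega>)"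
  by (rule integrable_mult_unit[OF _ real_cond_exp_binary_bounds assms]) simp

lemma real_cond_exp_binary_variance:
  assumes q: "q \<in> borel_measurable M" "AE \<omega> in M. real_cond_exp M F G \<omega> = q \<omega>"
  shows "AE \<omega> in M. real_cond_exp M F (\<lambda>\<omega>. (G \<omega> - q \<omega>)\<^sup>2) \<omega> = q \<omega> * (1 - q \<omega>)"
proof -
  let ?p = "real_cond_exp M F G"
  note [measurable] = q(1)
  have i1: "integrable M (\<lambda>\<omega>. (1 - 2 * ?p \<omega>) * G \<omega>)"
    using integrable_binary integrable_real_cond_exp_binary_mult[OF integrable_binary]
    by (simp add: left_diff_distrib mult.assoc)
  have i2: "integrable M (\<lambda>\<omega>. ?p \<omega> * ?p \<omega>)"
    by (intro integrable_real_cond_exp_binary_mult real_cond_exp_int integrable_binary)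
  \<comment> \<open>Writing \<open>?p\<close> for \<open>q\<close> makes the coefficients
    \<open>F\<close>-measurable, whereas \<open>q\<close> is only known to be measurable on
    \<open>M\<close>.\<close>
  have "AE \<omega> in M. (G \<omega> - q \<omega>)\<^sup>2 = (1 - 2 * ?p \<omega>) * G \<omega> + ?p \<omega> * ?p \<omega>"
    using q(2) AE_space
  proof eventually_elim
    case (elim \<omega>)
    then have "G \<omega> * G \<omega> = G \<omega>" using bin by fastforce
    then show ?case using elim by (simp add: power2_eq_square algebra_simps)
  qed
  then have "AE \<omega> in M. real_cond_exp M F (\<lambda>\<omega>. (G \<omega> - q \<omega>)\<^sup>2) \<omega>
      = real_cond_exp M F (\<lambda>\<omega>. (1 - 2 * ?p \<omega>) * G \<omega> + ?p \<omega> * ?p \<omega>) \<omega>"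
    by (rule real_cond_exp_cong) measurable
  moreover note real_cond_exp_add[OF i1 i2]
  moreover have "AE \<omega> in M. real_cond_exp M F (\<lambda>\<omega>. (1 - 2 * ?p \<omega>) * G \<omega>) \<omega> = (1 - 2 * ?p \<omega>) * ?p \<omega>"
    by (rule real_cond_exp_mult[OF _ G i1]) measurable
  moreover have "AE \<omega> in M. real_cond_exp M F (\<lambda>\<omega>. ?p \<omega> * ?p \<omega>) \<omega> = ?p \<omega> * ?p \<omega>"
    by (rule real_cond_exp_F_meas[OF i2]) measurable
  ultimately show ?thesis
    using q(2) by eventually_elim (auto simp: algebra_simps)
qed

end

end

section \<open>The weighted gap as a conditional covariance\<close>

lemma (in finite_measure) imbalance_term_eq_cond_cov:
  fixes X G W :: "'a \<Rightarrow> real"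
  assumes X [measurable]: "X \<in> borel_measurable M" and G [measurable]: "G \<in> borel_measurable M"
    and bin: "\<And>\<omega>. \<omega> \<in> space M \<Longrightarrow> G \<omega> \<in> {0, 1}"
    and W: "integrable M W"
  defines "F \<equiv> vimage_algebra (space M) X borel"
  shows "AE \<omega> in M. imbalance_term M X G W (X \<omega>)
    = real_cond_exp M F (\<lambda>\<omega>. G \<omega> * W \<omega>) \<omega> - real_cond_exp M F G \<omega> * real_cond_exp M F W \<omega>"
proof -
  define XG where "XG = (\<lambda>\<omega>. (X \<omega>, G \<omega>))"
  define H where "H = vimage_algebra (space M) XG (borel \<Otimes>\<^sub>M borel)"
  \<comment> \<open>The values \<open>c (x, 1)\<close> and \<open>c (x, 0)\<close> are the two group
    means at \<open>x\<close>, the \<open>a\<close> and \<open>b\<close> of the overview.\<close>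
  define c where "c = cond_exp_at M (borel \<Otimes>\<^sub>M borel) XG W"
  have XG: "XG \<in> measurable M (borel \<Otimes>\<^sub>M borel)"
    unfolding XG_def by measurable
  interpret finite_measure_subalgebra M F
    unfolding F_def by (rule finite_measure_subalgebra_vimage[OF X])
  have MH: "subalgebra M H"
    unfolding H_def by (rule subalgebra_vimage_algebra[OF XG])
  have GH: "G \<in> borel_measurable H" and XH: "X \<in> borel_measurable H"
    using measurable_comp_vimage_algebra[OF XG measurable_snd]
      measurable_comp_vimage_algebra[OF XG measurable_fst]
    by (simp_all add: XG_def H_def)
  have HF: "subalgebra H F"
    using subalgebra_vimage_algebra[OF XH] by (simp add: F_def H_def)
  have c [measurable]: "c \<in> borel_measurable (borel \<Otimes>\<^sub>M borel)"
    and cH: "AE \<omega> in M. real_cond_exp M H W \<omega> = c (X \<omega>, G \<omega>)"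
    using cond_exp_at_version[OF XG, of W] by (simp_all add: c_def H_def XG_def)
  have cF: "(\<lambda>\<omega>. c (X \<omega>, g)) \<in> borel_measurable F" for g
    unfolding F_def by (rule measurable_comp_vimage_algebra[OF X]) measurable
  have iG: "integrable M G" and iGW: "integrable M (\<lambda>\<omega>. G \<omega> * W \<omega>)"
    using integrable_binary[OF G bin] integrable_mult_binary[OF G bin W] by auto
  have eq1: "AE \<omega> in M. real_cond_exp M F (\<lambda>\<omega>. G \<omega> * W \<omega>) \<omega> = c (X \<omega>, 1) * real_cond_exp M F G \<omega>"
  proof (rule real_cond_exp_nested_factor[OF MH HF GH cF W iGW])
    \<comment> \<open>Both sides vanish where \<open>G\<close> is 0, and where \<open>G\<close> is 1
      the pair \<open>(X \<omega>, G \<omega>)\<close> is \<open>(X \<omega>, 1)\<close>. Arbitrary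
      values of \<open>c\<close> where a group is absent are thus harmless.\<close>
    show "AE \<omega> in M. G \<omega> * real_cond_exp M H W \<omega> = c (X \<omega>, 1) * G \<omega>"
      using cH AE_space by eventually_elim (use bin in force)
  qed
  have eq0: "AE \<omega> in M. real_cond_exp M F (\<lambda>\<omega>. (1 - G \<omega>) * W \<omega>) \<omega>
      = c (X \<omega>, 0) * real_cond_exp M F (\<lambda>\<omega>. 1 - G \<omega>) \<omega>"
  proof (rule real_cond_exp_nested_factor[OF MH HF _ cF W])
    show "(\<lambda>\<omega>. 1 - G \<omega>) \<in> borel_measurable H"
      using GH by measurable
    show "integrable M (\<lambda>\<omega>. (1 - G \<omega>) * W \<omega>)"
      using W iGW by (simp add: left_diff_distrib)
    show "AE \<omega> in M. (1 - G \<omega>) * real_cond_exp M H W \<omega> = c (X \<omega>, 0) * (1 - G \<omega>)"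
      using cH AE_space by eventually_elim (use bin in force)
  qed
  have "AE \<omega> in M. real_cond_exp M F (\<lambda>\<omega>. 1 - G \<omega>) \<omega> = 1 - real_cond_exp M F G \<omega>"
  proof -
    have "AE \<omega> in M. real_cond_exp M F (\<lambda>_. 1) \<omega> = 1"
      by (rule real_cond_exp_F_meas) auto
    with real_cond_exp_diff[OF integrable_const iG, of 1] show ?thesis
      by eventually_elim simp
  qed
  moreover have "AE \<omega> in M. real_cond_exp M F (\<lambda>\<omega>. (1 - G \<omega>) * W \<omega>) \<omega>
      = real_cond_exp M F W \<omega> - real_cond_exp M F (\<lambda>\<omega>. G \<omega> * W \<omega>) \<omega>"
    using real_cond_exp_diff[OF W iGW] by (simp add: left_diff_distrib)
  ultimately have W_eq: "AE \<omega> in M. real_cond_exp M F W \<omega>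
      = c (X \<omega>, 1) * real_cond_exp M F G \<omega> + c (X \<omega>, 0) * (1 - real_cond_exp M F G \<omega>)"
    using eq0 eq1 by eventually_elim simp
  have t: "imbalance_term M X G W x = (c (x, 1) - c (x, 0)) * cond_var_at M borel X G x" for x
    by (simp add: imbalance_term_def pointwise_imbalance_def c_def XG_def)
  \<comment> \<open>This is the very version that \<open>cond_var_at\<close> subtracts, so the
    variance formula applies to it.\<close>
  define q where "q = cond_exp_at M borel X G"
  have q [measurable]: "q \<in> borel_measurable borel"
    and qF: "AE \<omega> in M. real_cond_exp M F G \<omega> = q (X \<omega>)"
    using cond_exp_at_version[OF X, of G] by (simp_all add: q_def F_def)
  have "AE \<omega> in M. real_cond_exp M F (\<lambda>\<omega>. (G \<omega> - q (X \<omega>))\<^sup>2) \<omega> = cond_var_at M borel X G (X \<omega>)"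
    unfolding cond_var_at_def F_def q_def by (rule cond_exp_at_version(2)[OF X])
  moreover have "AE \<omega> in M. real_cond_exp M F (\<lambda>\<omega>. (G \<omega> - q (X \<omega>))\<^sup>2) \<omega> = q (X \<omega>) * (1 - q (X \<omega>))"
    by (rule real_cond_exp_binary_variance[OF G bin _ qF]) (auto intro: measurable_compose[OF X q])
  ultimately have "AE \<omega> in M. cond_var_at M borel X G (X \<omega>) = q (X \<omega>) * (1 - q (X \<omega>))"
    by eventually_elim simp
  \<comment> \<open>With \<open>q\<close> for the conditional mean of \<open>G\<close>, both sides
    are \<open>(a - b) * q * (1 - q)\<close>: the right one is
    \<open>a * q - q * (a * q + b * (1 - q))\<close>.\<close>
  with eq1 W_eq qF show ?thesis
  proof eventually_elim
    case (elim \<omega>)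
    show ?case
      unfolding t elim by (simp add: algebra_simps)
  qed
qed

lemma imbalance_term_measurable:
  assumes [measurable]: "X \<in> borel_measurable M" "G \<in> borel_measurable M"
  shows "imbalance_term M X G W \<in> borel_measurable borel"
proof -
  have "(\<lambda>\<omega>. (X \<omega>, G \<omega>)) \<in> measurable M (borel \<Otimes>\<^sub>M borel)"
    by measurable
  note [measurable] = cond_exp_at_version(1)[OF this, of W]
    cond_exp_at_version(1)[OF assms(1)]
  show ?thesis
    unfolding imbalance_term_def pointwise_imbalance_def cond_var_at_def by measurable
qed

text \<open>The conditional covariance is integrated over \<open>M\<close> after a change of
  variables from the law of \<open>X\<close>; total expectation simplifies its first term.
  Integrability rules out that the integral is merely the default value 0.\<close>

lemma (in finite_measure) imbalance_eq:
  fixes X G W :: "'a \<Rightarrow> real"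
  assumes X [measurable]: "X \<in> borel_measurable M" and G [measurable]: "G \<in> borel_measurable M"
    and bin: "\<And>\<omega>. \<omega> \<in> space M \<Longrightarrow> G \<omega> \<in> {0, 1}"
    and W: "integrable M W"
  defines "F \<equiv> vimage_algebra (space M) X borel"
  shows "integrable (distr M borel X) (imbalance_term M X G W)"
    and "imbalance M X G W
      = (\<integral>\<omega>. G \<omega> * W \<omega> \<partial>M) - (\<integral>\<omega>. real_cond_exp M F G \<omega> * real_cond_exp M F W \<omega> \<partial>M)"
proof -
  interpret finite_measure_subalgebra M F
    unfolding F_def by (rule finite_measure_subalgebra_vimage[OF X])
  let ?t = "imbalance_term M X G W"
  let ?r = "\<lambda>\<omega>. real_cond_exp M F (\<lambda>\<omega>. G \<omega> * W \<omega>) \<omega> - real_cond_exp M F G \<omega> * real_cond_exp M F W \<omega>"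
  have t [measurable]: "?t \<in> borel_measurable borel"
    by (rule imbalance_term_measurable[OF X G])
  have ae: "AE \<omega> in M. ?t (X \<omega>) = ?r \<omega>"
    unfolding F_def by (rule imbalance_term_eq_cond_cov[OF X G bin W])
  have iGW: "integrable M (\<lambda>\<omega>. G \<omega> * W \<omega>)"
    by (rule integrable_mult_binary[OF G bin W])
  have i1: "integrable M (\<lambda>\<omega>. real_cond_exp M F G \<omega> * real_cond_exp M F W \<omega>)"
    by (rule integrable_real_cond_exp_binary_mult[OF G bin real_cond_exp_int(1)[OF W]])
  have r: "integrable M ?r"
    using real_cond_exp_int(1)[OF iGW] i1 by simp
  have "integrable M (\<lambda>\<omega>. ?t (X \<omega>))"
    by (rule integrable_cong_AE_imp[OF r]) (use ae in auto)
  then show "integrable (distr M borel X) ?t"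
    by (simp add: integrable_distr_eq)
  have "imbalance M X G W = (\<integral>\<omega>. ?t (X \<omega>) \<partial>M)"
    by (simp add: imbalance_def integral_distr)
  also have "\<dots> = (\<integral>\<omega>. ?r \<omega> \<partial>M)"
    by (rule integral_cong_AE) (use ae in auto)
  finally show "imbalance M X G W
      = (\<integral>\<omega>. G \<omega> * W \<omega> \<partial>M) - (\<integral>\<omega>. real_cond_exp M F G \<omega> * real_cond_exp M F W \<omega> \<partial>M)"
    using real_cond_exp_int[OF iGW] i1 by simp
qed

section \<open>Exchanging outcome and score, and assembling the covariance\<close>

lemma miscalibration_term_eq_imbalance_term:
  "miscalibration_term M Y G Z = imbalance_term M Z G Y"
  by (simp add: fun_eq_iff miscalibration_term_def imbalance_term_def
      pointwise_miscalibration_def pointwise_imbalance_def)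

text \<open>This symmetry lets \<open>imbalance_eq\<close> evaluate both sums.\<close>

lemma miscalibration_eq_imbalance: "miscalibration M Y G Z = imbalance M Z G Y"
  by (simp add: miscalibration_def imbalance_def miscalibration_term_eq_imbalance_term)

lemma covariance_eq:
  assumes "prob_space M" "integrable M U" "integrable M V" "integrable M (\<lambda>\<omega>. U \<omega> * V \<omega>)"
  shows "covariance M U V = (\<integral>\<omega>. U \<omega> * V \<omega> \<partial>M) - (\<integral>\<omega>. U \<omega> \<partial>M) * (\<integral>\<omega>. V \<omega> \<partial>M)"
proof -
  interpret prob_space M by fact
  show ?thesis
    using assms(2-) by (simp add: covariance_def left_diff_distrib right_diff_distrib prob_space)
qed

theorem proposition2:
  fixes M :: "'a measure" and Y G Z :: "'a \<Rightarrow> real"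
  assumes "prob_space M"
    and "Y \<in> borel_measurable M" and "G \<in> borel_measurable M" and "Z \<in> borel_measurable M"
    and "integrable M Y" and "integrable M (\<lambda>\<omega>. (Y \<omega>)\<^sup>2)"
    and "integrable M Z" and "integrable M (\<lambda>\<omega>. (Z \<omega>)\<^sup>2)"
    and "\<And>\<omega>. \<omega> \<in> space M \<Longrightarrow> G \<omega> \<in> {0, 1}"
    and "globally_calibrated M Y Z"
  shows "integrable (distr M borel Y) (imbalance_term M Y G Z)
    \<and> integrable (distr M borel Z) (miscalibration_term M Y G Z)
    \<and> imbalance M Y G Z + miscalibration M Y G Z
      = covariance M
          (real_cond_exp M (vimage_algebra (space M) Y borel) G)
          (\<lambda>\<omega>. Y \<omega> - real_cond_exp M (vimage_algebra (space M) Y borel) Z \<omega>)"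
proof -
  interpret prob_space M by fact
  note Y = assms(2) and G = assms(3) and Z = assms(4) and iY = assms(5) and iZ = assms(7)
    and bin = assms(9)
  let ?FY = "vimage_algebra (space M) Y borel" and ?FZ = "vimage_algebra (space M) Z borel"
  let ?p = "real_cond_exp M ?FY G" and ?q = "real_cond_exp M ?FZ G"
  let ?m = "real_cond_exp M ?FY Z"
  interpret FY: finite_measure_subalgebra M ?FY
    by (rule finite_measure_subalgebra_vimage[OF Y])
  interpret FZ: finite_measure_subalgebra M ?FZ
    by (rule finite_measure_subalgebra_vimage[OF Z])
  have iG: "integrable M G"
    by (rule FY.integrable_binary[OF G bin])
  \<comment> \<open>Measurability of this set is what carries calibration from the law of
    \<open>Z\<close> back to \<open>M\<close>.\<close>
  have "{z. cond_exp_at M borel Z Y z = z} \<in> sets borel"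
    using cond_exp_at_version(1)[OF Z, of Y] by measurable
  then have "AE \<omega> in M. cond_exp_at M borel Z Y (Z \<omega>) = Z \<omega>"
    using assms(10) Z by (simp add: globally_calibrated_def AE_distr_iff)
  with cond_exp_at_version(2)[OF Z, of Y]
  have cal: "AE \<omega> in M. real_cond_exp M ?FZ Y \<omega> = Z \<omega>"
    by auto
  have means: "(\<integral>\<omega>. Y \<omega> \<partial>M) = (\<integral>\<omega>. Z \<omega> \<partial>M)"
    using integral_cong_AE[OF _ _ cal] FZ.real_cond_exp_int(2)[OF iY] Z by simp
  have Z_self: "Z \<in> borel_measurable ?FZ" and Y_self: "Y \<in> borel_measurable ?FY"
    using measurable_comp_vimage_algebra[OF Z measurable_ident]
      measurable_comp_vimage_algebra[OF Y measurable_ident] by simp_all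
  have iGY: "integrable M (\<lambda>\<omega>. Y \<omega> * G \<omega>)" and iGZ: "integrable M (\<lambda>\<omega>. Z \<omega> * G \<omega>)"
    using FY.integrable_mult_binary[OF G bin iY] FY.integrable_mult_binary[OF G bin iZ]
    by (simp_all add: mult.commute)
  \<comment> \<open>Calibration replaces the conditional mean of \<open>Y\<close> by
    \<open>Z\<close>; as \<open>Z\<close> is measurable for \<open>?FZ\<close>, \<open>?q\<close>
    may then be replaced by \<open>G\<close> under the integral.\<close>
  have "(\<integral>\<omega>. ?q \<omega> * real_cond_exp M ?FZ Y \<omega> \<partial>M) = (\<integral>\<omega>. Z \<omega> * ?q \<omega> \<partial>M)"
    by (rule integral_cong_AE) (use cal Z in auto)
  also have "\<dots> = (\<integral>\<omega>. G \<omega> * Z \<omega> \<partial>M)"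
    using FZ.real_cond_exp_intg(2)[OF iGZ Z_self G] by (simp add: mult.commute)
  finally have mis: "miscalibration M Y G Z = (\<integral>\<omega>. G \<omega> * Y \<omega> \<partial>M) - (\<integral>\<omega>. G \<omega> * Z \<omega> \<partial>M)"
    using imbalance_eq(2)[OF Z G bin iY] by (simp add: miscalibration_eq_imbalance)
  have im: "integrable M ?m" and mean_m: "(\<integral>\<omega>. ?m \<omega> \<partial>M) = (\<integral>\<omega>. Z \<omega> \<partial>M)"
    using FY.real_cond_exp_int[OF iZ] by auto
  note ipY = FY.integrable_real_cond_exp_binary_mult[OF G bin iY]
    and ipm = FY.integrable_real_cond_exp_binary_mult[OF G bin im]
  have "covariance M ?p (\<lambda>\<omega>. Y \<omega> - ?m \<omega>)
      = (\<integral>\<omega>. ?p \<omega> * (Y \<omega> - ?m \<omega>) \<partial>M) - (\<integral>\<omega>. ?p \<omega> \<partial>M) * (\<integral>\<omega>. Y \<omega> - ?m \<omega> \<partial>M)"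
    by (rule covariance_eq)
      (use iY im ipY ipm FY.real_cond_exp_int(1)[OF iG] in \<open>auto simp: right_diff_distrib prob_space_axioms\<close>)
  \<comment> \<open>The product of means drops out because \<open>Y\<close> and \<open>?m\<close>
    both have the mean of \<open>Z\<close>.\<close>
  also have "\<dots> = (\<integral>\<omega>. ?p \<omega> * Y \<omega> \<partial>M) - (\<integral>\<omega>. ?p \<omega> * ?m \<omega> \<partial>M)"
    using iY im ipY ipm means mean_m by (simp add: right_diff_distrib)
  also have "(\<integral>\<omega>. ?p \<omega> * Y \<omega> \<partial>M) = (\<integral>\<omega>. G \<omega> * Y \<omega> \<partial>M)"
    using FY.real_cond_exp_intg(2)[OF iGY Y_self G] by (simp add: mult.commute)
  \<comment> \<open>The integral of \<open>G * Z\<close> enters the imbalance with a plus sign and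
    the miscalibration with a minus sign, so it cancels.\<close>
  finally show ?thesis
    using imbalance_eq[OF Y G bin iZ] imbalance_eq(1)[OF Z G bin iY] mis
    by (simp add: miscalibration_term_eq_imbalance_term)
qed

end
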